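(* Let $N$ be an odd perfect number with canonical factorization $N = \prod_{i=1}^{t} p_i^{\alpha_i}$, where $p_1 < p_2 < \cdots < p_t$ are primes, $t = \omega(N)$, and $\alpha_i > 0$ for all $i$. Then for every $i$ with $1 \le i \le t$, $$\sigma(p_i^{\alpha_i}) \le \frac{2}{3}\cdot\frac{N}{p_i^{\alpha_i}}.$$
   Context: $\sigma(n)$ denotes the sum of the positive divisors of $n$; $\omega(n)$ is the number of distinct prime divisors of $n$. An odd perfect number is an odd positive integer $N$ with $\sigma(N)=2N$. *)

theory Defs
  imports Complex_Main "HOL-Computational_Algebra.Primes"
begin

definition divisor_sigma :: "nat \<Rightarrow> nat" where
  "divisor_sigma n = (\<Sum>d | d dvd n. d)"

definition prime_omega :: "nat \<Rightarrow> nat" where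
  "prime_omega n = card {p. prime p \<and> p dvd n}"

definition odd_perfect :: "nat \<Rightarrow> bool" where
  "odd_perfect N \<longleftrightarrow> odd N \<and> 0 < N \<and> divisor_sigma N = 2 * N"

end

theory Submission
  imports Defs "HOL-Number_Theory.Number_Theory"
begin

text \<open>
  Write \<open>N = p ^ a * M\<close> with \<open>p\<close> not dividing \<open>M\<close>. Since \<open>\<sigma>(p ^ a)\<close> is prime to \<open>p\<close>, there is \<open>m\<close> with
  \<open>\<sigma>(M) = m p ^ a\<close> and \<open>m \<sigma>(p ^ a) = 2 M\<close>, and the claim is that \<open>m \<ge> 3\<close>.

  Suppose \<open>m \<le> 2\<close> and let \<open>r ^ k\<close> exactly divide \<open>M\<close>. Then \<open>\<sigma>(r ^ k)\<close> divides \<open>2 p ^ a\<close>.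
  If \<open>\<sigma>(r ^ k) = p ^ c\<close>, then \<open>k \<ge> 2\<close> is even, \<open>p ^ c \<equiv> 1 + r\<close> and \<open>p ^ (a + 1) \<equiv> 1\<close> modulo \<open>r\<^sup>2\<close>,
  so \<open>1 + (a + 1) r \<equiv> p ^ (c (a + 1)) \<equiv> 1\<close> and \<open>r\<close> divides \<open>a + 1\<close>. If \<open>\<sigma>(r ^ k) = 2 p ^ c\<close>, then
  \<open>k = 1\<close> and \<open>r = 2 p ^ c - 1\<close>; at most one such prime \<open>r\<close> occurs, because \<open>4\<close> does not divide
  \<open>2 p ^ a\<close>.

  Let \<open>e\<close> be the largest odd prime factor of \<open>a + 1\<close>. The number \<open>D = (p ^ e - 1) / (p - 1)\<close>
  divides \<open>M\<close>, exceeds \<open>e\<close>, is not divisible by \<open>e\<^sup>2\<close>, and its prime factors other than \<open>e\<close> are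
  \<open>1\<close> modulo \<open>e\<close>, so by maximality they do not divide \<open>a + 1\<close>. Hence \<open>D = r\<close> or \<open>D = e r\<close> for the
  exceptional prime \<open>r\<close>. As \<open>D \<equiv> 1\<close> and \<open>r \<equiv> -1\<close> modulo \<open>p\<close>, the first is impossible, and the
  second gives \<open>p dvd e + 1\<close> together with \<open>e dvd p - 1\<close>, that is \<open>p = e + 1\<close>, against parity.
\<close>

section \<open>Divisor sums and geometric sums\<close>

lemma divisor_sigma_mult_coprime:
  assumes "coprime m n" "m > 0" "n > 0"
  shows "divisor_sigma (m * n) = divisor_sigma m * divisor_sigma n"
proof -
  have inj: "inj_on (\<lambda>(a, b). a * b) ({d. d dvd m} \<times> {d. d dvd n})"
  proof (rule inj_onI, clarsimp)
    fix a b c d assume *: "a dvd m" "b dvd n" "c dvd m" "d dvd n" "a * b = c * d"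
    have cop: "coprime x y" if "x dvd m" "y dvd n" for x y
      using that assms(1) by (meson coprime_divisors)
    have "a dvd c * d" "c dvd a * b" using *(5) by (metis dvd_triv_left)+
    then have ac: "a = c"
      using * cop by (meson coprime_dvd_mult_left_iff dvd_antisym)
    moreover have "a \<noteq> 0" using *(1) assms(2) by auto
    ultimately show "a = c \<and> b = d" using *(5) by simp
  qed
  have img: "{d. d dvd m * n} = (\<lambda>(a, b). a * b) ` ({d. d dvd m} \<times> {d. d dvd n})"
    by (force simp: mult_dvd_mono elim: dvd_productE)
  have "divisor_sigma (m * n) = (\<Sum>x\<in>{d. d dvd m} \<times> {d. d dvd n}. case x of (a, b) \<Rightarrow> a * b)"
    unfolding divisor_sigma_def img by (subst sum.reindex[OF inj]) simp
  also have "\<dots> = divisor_sigma m * divisor_sigma n"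
    unfolding divisor_sigma_def by (simp add: sum_product sum.cartesian_product)
  finally show ?thesis .
qed

lemma divisor_sigma_prime_power:
  assumes "prime (p::nat)"
  shows "divisor_sigma (p ^ k) = (\<Sum>i<Suc k. p ^ i)"
proof -
  have "{d. d dvd p ^ k} = (\<lambda>i. p ^ i) ` {..<Suc k}"
    using assms by (auto simp: divides_primepow_nat less_Suc_eq_le)
  moreover have "inj_on (\<lambda>i. p ^ i) {..<Suc k}"
    using prime_gt_1_nat[OF assms] by (auto intro!: inj_onI)
  ultimately show ?thesis
    unfolding divisor_sigma_def by (simp add: sum.reindex)
qed

lemma geometric_sum_nat:
  fixes x :: nat assumes "x > 0"
  shows "(x - 1) * (\<Sum>i<n. x ^ i) + 1 = x ^ n"
proof (induction n)
  case (Suc n)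
  have "(x - 1) * (\<Sum>i<Suc n. x ^ i) + 1 = x ^ n + (x - 1) * x ^ n"
    using Suc by (simp add: algebra_simps)
  also have "\<dots> = x ^ Suc n"
    using assms by (cases x) auto
  finally show ?case .
qed simp

lemma odd_geometric_sum_iff:
  "odd (x::nat) \<Longrightarrow> odd (\<Sum>i<n. x ^ i) \<longleftrightarrow> odd n"
  by (induction n) auto

text \<open>With \<open>n = e * k\<close>, the terms group into \<open>k\<close> blocks of length
  \<open>e\<close>, each a power of \<open>x ^ e\<close> times the first block.\<close>

lemma geometric_sum_dvd:
  fixes x :: nat assumes "e dvd n"
  shows "(\<Sum>i<e. x ^ i) dvd (\<Sum>i<n. x ^ i)"
proof -
  obtain k where k: "n = e * k" using assms by auto
  have "(\<Sum>i<e * k. x ^ i) = (\<Sum>i<e. x ^ i) * (\<Sum>j<k. (x ^ e) ^ j)"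
  proof (induction k)
    case (Suc k)
    have "(\<Sum>i<e * Suc k. x ^ i) = (\<Sum>i<e * k + e. x ^ i)" by (simp add: add.commute)
    also have "\<dots> = (\<Sum>i<e * k. x ^ i) + (\<Sum>i<e. x ^ (e * k + i))"
    proof -
      have "(\<Sum>i<a + b. f i) = (\<Sum>i<a. f i) + (\<Sum>i<b. f (a + i))" for a b and f :: "nat \<Rightarrow> nat"
        by (induction b) auto
      then show ?thesis .
    qed
    also have "\<dots> = (\<Sum>i<e. x ^ i) * (\<Sum>j<Suc k. (x ^ e) ^ j)"
      by (simp add: Suc power_add power_mult sum_distrib_left sum_distrib_right algebra_simps)
    finally show ?case .
  qed simp
  then show ?thesis using k by simp
qed

section \<open>Congruences modulo squares and prime divisors of geometric sums\<close>

lemma cong_one_plus_power: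
  fixes s y :: nat
  shows "[(1 + s * y) ^ n = 1 + n * (s * y)] (mod s\<^sup>2)"
proof (induction n)
  case (Suc n)
  have "[(1 + s * y) * (1 + s * y) ^ n = (1 + s * y) * (1 + n * (s * y))] (mod s\<^sup>2)"
    using Suc cong_scalar_left by blast
  also have "(1 + s * y) * (1 + n * (s * y)) = (1 + Suc n * (s * y)) + s\<^sup>2 * (n * y\<^sup>2)"
    by (simp add: algebra_simps power2_eq_square)
  also have "[\<dots> = 1 + Suc n * (s * y)] (mod s\<^sup>2)"
    by (simp add: cong_def)
  finally show ?case by simp
qed simp

text \<open>Modulo \<open>r\<^sup>2\<close>, \<open>p ^ (c * n)\<close> is both
  \<open>(1 + r) ^ n\<close>, hence \<open>1 + n * r\<close>, and a power of \<open>p ^ n\<close>,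
  hence 1.\<close>

lemma dvd_exponent_if_cong_one_mod_square:
  fixes p r :: nat
  assumes r: "r > 0" and k: "k \<ge> 2" and c: "p ^ c = (\<Sum>i<Suc k. r ^ i)"
    and n: "[p ^ n = 1] (mod r\<^sup>2)"
  shows "r dvd n"
proof -
  \<comment> \<open>As \<open>k \<ge> 2\<close>, splitting off two terms leaves \<open>k - 1\<close>
    multiples of \<open>r\<^sup>2\<close>.\<close>
  have "p ^ c = 1 + r + r\<^sup>2 * (\<Sum>i<k - 1. r ^ i)"
  proof -
    obtain l where l: "k = Suc l" using k by (cases k) auto
    show ?thesis unfolding c l
      by (simp add: sum.lessThan_Suc_shift sum_distrib_left power2_eq_square mult.assoc del: sum.lessThan_Suc)
  qed
  then have "[p ^ c = 1 + r * 1] (mod r\<^sup>2)" by (simp add: cong_def)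
  then have "[(p ^ c) ^ n = (1 + r * 1) ^ n] (mod r\<^sup>2)" by (rule cong_pow)
  also have "[(1 + r * 1) ^ n = 1 + n * (r * 1)] (mod r\<^sup>2)" by (rule cong_one_plus_power)
  finally have 1: "[(p ^ c) ^ n = 1 + n * r] (mod r\<^sup>2)" by simp
  have "[(p ^ n) ^ c = 1 ^ c] (mod r\<^sup>2)" using n by (rule cong_pow)
  then have "[(p ^ c) ^ n = 1] (mod r\<^sup>2)" by (simp add: mult.commute flip: power_mult)
  with 1 have "[1 + n * r = 1 + 0] (mod r\<^sup>2)" by (metis add_0_right cong_sym cong_trans)
  then have "[n * r = 0] (mod r\<^sup>2)" using cong_add_lcancel_nat by blast
  then have "r * r dvd n * r" by (simp add: cong_0_iff power2_eq_square)
  then show ?thesis using r by simp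
qed

text \<open>The divisibility gives \<open>p ^ e\<close> congruent to 1 modulo \<open>e\<close>,
  while Fermat gives \<open>p ^ e\<close> congruent to \<open>p\<close>.\<close>

lemma dvd_prime_geometric_sum_imp_dvd_pred:
  fixes p e :: nat
  assumes e: "prime e" and p: "p > 0" and d: "e dvd (\<Sum>i<e. p ^ i)"
  shows "e dvd p - 1"
proof -
  have pe: "e dvd p ^ e - 1"
    using geometric_sum_nat[OF p, of e] d by (metis add_diff_cancel_right' dvd_mult)
  then have c: "[p ^ e = 1] (mod e)" using p by (metis One_nat_def Suc_leI cong_altdef_nat cong_sym zero_less_power)
  have ne: "\<not> e dvd p"
  proof
    assume "e dvd p"
    then have "[p ^ e = 0] (mod e)" using e by (meson cong_0_iff dvd_power dvd_trans prime_gt_0_nat)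
    then have "[1 = 0] (mod e)" using c cong_sym cong_trans by blast
    then show False using e by (simp add: cong_0_iff)
  qed
  have "[p ^ (e - 1) = 1] (mod e)" using e ne by (rule fermat_theorem)
  then have "[p * p ^ (e - 1) = p * 1] (mod e)" by (rule cong_scalar_left)
  moreover have "p * p ^ (e - 1) = p ^ e" using prime_gt_0_nat[OF e] by (metis power_eq_if not_gr_zero)
  ultimately have "[p = 1] (mod e)" using c by (metis cong_sym cong_trans mult.right_neutral)
  then show ?thesis using p by (metis One_nat_def Suc_leI cong_altdef_nat)
qed

text \<open>Otherwise \<open>p = 1 + e * y\<close>, and modulo \<open>e\<^sup>2\<close> the sum is
  \<open>e\<close> plus \<open>e * y\<close> times the sum of all \<open>i < e\<close>. For odd
  \<open>e\<close> that last sum is a multiple of \<open>e\<close>, so only \<open>e\<close>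
  remains.\<close>

lemma square_not_dvd_prime_geometric_sum:
  fixes p e :: nat
  assumes e: "prime e" "odd e" and p: "p > 0"
  shows "\<not> e\<^sup>2 dvd (\<Sum>i<e. p ^ i)"
proof
  assume d: "e\<^sup>2 dvd (\<Sum>i<e. p ^ i)"
  then have "e dvd p - 1"
    using dvd_prime_geometric_sum_imp_dvd_pred[OF e(1) p] by (meson dvd_power dvd_trans pos2)
  then obtain y where "p - 1 = e * y" by auto
  then have y: "p = 1 + e * y" using p by simp
  have "[(\<Sum>i<e. p ^ i) = (\<Sum>i<e. 1 + i * (e * y))] (mod e\<^sup>2)"
    unfolding y by (intro cong_sum cong_one_plus_power)
  also have "(\<Sum>i<e. 1 + i * (e * y)) = e + (\<Sum>i<e. i) * (e * y)"
    unfolding sum.distrib by (simp add: sum_distrib_right)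
  also have "(\<Sum>i<e. i) = e * ((e - 1) div 2)"
  proof -
    obtain h where h: "e = 2 * h + 1" using e(2) by (auto elim: oddE)
    have "(\<Sum>i<2 * h + 1. i) = (2 * h + 1) * h" by (induction h) (auto simp: algebra_simps)
    then show ?thesis using h by simp
  qed
  also have "[e + e * ((e - 1) div 2) * (e * y) = e] (mod e\<^sup>2)"
  proof -
    have "e + e * ((e - 1) div 2) * (e * y) = e + e\<^sup>2 * (((e - 1) div 2) * y)"
      by (simp add: power2_eq_square algebra_simps)
    then show ?thesis by (metis cong_def mod_mult_self2)
  qed
  finally have "e\<^sup>2 dvd e" using d by (simp add: cong_dvd_iff)
  then have "e * e \<le> e * 1" using prime_gt_0_nat[OF e(1)] by (auto simp: power2_eq_square dest: dvd_imp_le)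
  then show False using prime_gt_1_nat[OF e(1)] by simp
qed

text \<open>The order of \<open>p\<close> modulo \<open>r\<close> divides the prime
  \<open>e\<close>. Order 1 makes the sum congruent to \<open>e\<close>, so \<open>r = e\<close>;
  order \<open>e\<close> divides \<open>r - 1\<close>.\<close>

lemma prime_divisor_prime_geometric_sum:
  fixes p e r :: nat
  assumes e: "prime e" and r: "prime r" and p: "p > 0" and d: "r dvd (\<Sum>i<e. p ^ i)"
  shows "r = e \<or> e dvd r - 1"
proof -
  have "r dvd p ^ e - 1"
    using geometric_sum_nat[OF p, of e] d by (metis add_diff_cancel_right' dvd_mult)
  then have c: "[p ^ e = 1] (mod r)" using p by (metis One_nat_def Suc_leI cong_altdef_nat zero_less_power)
  then have "ord r p dvd e" using ord_divides by blast
  then consider "ord r p = 1" | "ord r p = e" using e by (auto simp: prime_nat_iff)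
  then show ?thesis
  proof cases
    case 1
    then have p1: "[p = 1] (mod r)" using ord[of p r] by simp
    have "[(\<Sum>i<e. p ^ i) = (\<Sum>i<e. 1)] (mod r)"
      using cong_pow[OF p1] by (intro cong_sum) simp
    then have "r dvd e" using d by (simp add: cong_dvd_iff)
    then show ?thesis using e r by (simp add: primes_dvd_imp_eq)
  next
    case 2
    have "coprime r p"
      using c prime_gt_0_nat[OF e] by (metis coprime_commute coprime_power_left_iff cong_imp_coprime cong_sym coprime_1_left neq0_conv)
    then have "ord r p dvd totient r" by (rule order_divides_totient)
    then show ?thesis using 2 r by (simp add: totient_prime)
  qed
qed

section \<open>Prime factors of the cofactor \<open>M\<close>\<close>

lemma dvd_twice_prime_power:
  fixes p x :: nat
  assumes "prime p" "x dvd 2 * p ^ a"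
  obtains c where "odd x" "x = p ^ c" | c where "even x" "x = 2 * p ^ c"
proof (cases "odd x")
  case True
  then have "x dvd p ^ a" using assms(2) by (metis coprime_dvd_mult_right_iff coprime_right_2_iff_odd)
  then show ?thesis using that(1) True assms(1) by (auto simp: divides_primepow_nat)
next
  case False
  then obtain y where y: "x = 2 * y" by auto
  then have "y dvd p ^ a" using assms(2) by simp
  then show ?thesis using that(2) False y assms(1) by (auto simp: divides_primepow_nat)
qed

text \<open>Writing \<open>k + 1 = 2 j\<close>, the sum factors as \<open>(r ^ j + 1) (1 + r + \<dots> + r ^ (j - 1))\<close>, and
  the odd prime \<open>p\<close> cannot divide both factors.\<close>
lemma geometric_sum_eq_twice_prime_power:
  fixes p r :: nat
  assumes p: "prime p" "odd p" and r: "odd r" "r > 1" and c: "(\<Sum>i<Suc k. r ^ i) = 2 * p ^ c"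
  shows "k = 1 \<and> r + 1 = 2 * p ^ c \<and> c > 0"
proof -
  have "even (Suc k)" using odd_geometric_sum_iff[OF r(1), of "Suc k"] c by (simp del: sum.lessThan_Suc)
  then obtain j where j: "Suc k = j * 2" by (metis evenE mult.commute)
  have split: "(\<Sum>i<Suc k. r ^ i) = (\<Sum>i<j. r ^ i) * (r ^ j + 1)"
  proof -
    \<comment> \<open>Difference of squares, stated without subtraction.\<close>
    have square: "x * (y + 1) + 1 = y * y" if "x + 1 = y" for x y :: nat
      using that by (auto simp: algebra_simps)
    have "(r - 1) * (\<Sum>i<Suc k. r ^ i) + 1 = r ^ j * r ^ j"
      using geometric_sum_nat[of r "Suc k"] r j by (simp only: power_mult power2_eq_square)
    moreover have "(r - 1) * (\<Sum>i<j. r ^ i) + 1 = r ^ j" using geometric_sum_nat r by simp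
    then have "((r - 1) * (\<Sum>i<j. r ^ i)) * (r ^ j + 1) + 1 = r ^ j * r ^ j"
      by (rule square)
    ultimately have "(r - 1) * (\<Sum>i<Suc k. r ^ i) = (r - 1) * ((\<Sum>i<j. r ^ i) * (r ^ j + 1))"
      by (metis add_right_imp_eq mult.assoc)
    then show ?thesis using r by (metis mult_left_cancel not_less zero_less_diff neq0_conv)
  qed
  have j0: "j > 0" using j by (cases j) auto
  have "r ^ 1 \<le> r ^ j" using j0 r by (intro power_increasing) auto
  then have big: "r ^ j + 1 > 2" using r by simp
  have dv: "r ^ j + 1 dvd 2 * p ^ c" "(\<Sum>i<j. r ^ i) dvd 2 * p ^ c"
    using split c by (metis dvd_triv_right, metis dvd_triv_left)
  \<comment> \<open>A divisor of \<open>2 * p ^ c\<close> that is prime to \<open>p\<close> is 1 or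
    2. This rules out \<open>r ^ j + 1\<close>, and later bounds the other factor by 2.\<close>
  have pd: "p dvd r ^ j + 1"
    using dvd_twice_prime_power[OF p(1) dv(1)]
  proof cases
    case (1 c) then show ?thesis using big r by (cases c) auto
  next
    case (2 c) then show ?thesis using big r by (cases c) auto
  qed
  have np: "\<not> p dvd (\<Sum>i<j. r ^ i)"
  proof
    assume "p dvd (\<Sum>i<j. r ^ i)"
    then have "p dvd (r - 1) * (\<Sum>i<j. r ^ i)" by simp
    moreover have "r ^ j + 1 = (r - 1) * (\<Sum>i<j. r ^ i) + 2" using geometric_sum_nat[of r j] r by simp
    ultimately have "p dvd 2" using pd by (metis dvd_add_right_iff)
    then show False using p by (metis primes_dvd_imp_eq two_is_prime_nat even_numeral dvd_refl)
  qed
  have "j = 1"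
  proof (rule ccontr)
    assume "j \<noteq> 1"
    then obtain l where l: "j = Suc (Suc l)" using j0 by (metis One_nat_def gr0_implies_Suc not_gr_zero)
    have "(\<Sum>i<j. r ^ i) > 2"
      using r by (simp add: l sum.lessThan_Suc_shift del: sum.lessThan_Suc)
    moreover from dvd_twice_prime_power[OF p(1) dv(2)] have "(\<Sum>i<j. r ^ i) \<le> 2"
    proof cases
      case (1 c) then show ?thesis using np by (cases c) auto
    next
      case (2 c) then show ?thesis using np by (cases c) auto
    qed
    ultimately show False by simp
  qed
  then have "r + 1 = 2 * p ^ c" "k = 1" using split c j by auto
  moreover have "c > 0" using calculation r by (cases c) auto
  ultimately show ?thesis by simp
qed

lemma prime_power_split:
  fixes M r :: nat
  assumes "prime r" "M > 0" "r dvd M"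
  obtains k M' where "M = r ^ k * M'" "k > 0" "\<not> r dvd M'" "M' > 0" "coprime (r ^ k) M'"
    "divisor_sigma M = divisor_sigma (r ^ k) * divisor_sigma M'"
proof -
  obtain k M' where *: "M = r ^ k * M'" "\<not> r dvd M'"
    using multiplicity_decompose'[of M r] assms by (metis mult.commute not_gr_zero not_prime_unit)
  have "k > 0" using * assms(3) by (cases k) auto
  moreover have M': "M' > 0" using * assms(2) by auto
  moreover have cop: "coprime (r ^ k) M'" using *(2) assms(1) by (simp add: prime_imp_coprime)
  ultimately show ?thesis
    using that * divisor_sigma_mult_coprime[OF cop] assms by (simp add: prime_gt_0_nat)
qed

text \<open>The parity of \<open>divisor_sigma (r ^ k)\<close>, for \<open>r ^ k\<close> exactly
  dividing \<open>M\<close>, decides: odd leads to the first alternative, even to the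
  second.\<close>

lemma prime_factor_cases:
  fixes p a M r :: nat
  assumes p: "prime p" "odd p" and M: "odd M" "divisor_sigma M dvd 2 * p ^ a"
    and dM: "M dvd divisor_sigma (p ^ a)" and r: "prime r" "r dvd M"
  shows "r dvd a + 1 \<or>
    (even (divisor_sigma r) \<and> p dvd r + 1 \<and> \<not> r\<^sup>2 dvd M)"
proof -
  have M0: "M > 0" using M(1) by (cases M) auto
  have ro: "odd r" using r(2) M(1) by (meson dvd_trans)
  obtain k M' where k: "M = r ^ k * M'" "k > 0" "\<not> r dvd M'"
    "divisor_sigma M = divisor_sigma (r ^ k) * divisor_sigma M'"
    using prime_power_split[OF r(1) M0 r(2)] by metis
  have "divisor_sigma (r ^ k) dvd 2 * p ^ a" using k(4) M(2) by (metis dvd_mult_left)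
  with p(1) show ?thesis
  proof (cases rule: dvd_twice_prime_power)
    case (1 c)
    then have s: "p ^ c = (\<Sum>i<Suc k. r ^ i)" using divisor_sigma_prime_power[OF r(1)] by simp
    then have "odd (Suc k)" using odd_geometric_sum_iff[OF ro, of "Suc k"] 1(1) 1(2) by simp
    \<comment> \<open>\<open>k\<close> is even and positive, so \<open>r\<^sup>2\<close> divides
      \<open>M\<close> and therefore \<open>p ^ Suc a - 1\<close>.\<close>
    then have k2: "k \<ge> 2" using k(2) by (cases k; cases "k - 1") auto
    then have "r\<^sup>2 dvd divisor_sigma (p ^ a)"
      using k(1) dM by (meson dvd_trans dvd_triv_left le_imp_power_dvd)
    then have "r\<^sup>2 dvd (p - 1) * (\<Sum>i<Suc a. p ^ i)" 
      using divisor_sigma_prime_power[OF p(1)] by simp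
    then have "[(p - 1) * (\<Sum>i<Suc a. p ^ i) + 1 = 0 + 1] (mod r\<^sup>2)"
      by (intro cong_add) (auto simp: cong_0_iff)
    then have "[p ^ Suc a = 1] (mod r\<^sup>2)"
      using geometric_sum_nat[OF prime_gt_0_nat[OF p(1)], of "Suc a"] by (simp del: sum.lessThan_Suc)
    from dvd_exponent_if_cong_one_mod_square[OF prime_gt_0_nat[OF r(1)] k2 s this]
    show ?thesis by simp
  next
    case (2 c)
    then have "(\<Sum>i<Suc k. r ^ i) = 2 * p ^ c" using divisor_sigma_prime_power[OF r(1)] by simp
    from geometric_sum_eq_twice_prime_power[OF p ro prime_gt_1_nat[OF r(1)] this]
    have "k = 1 \<and> r + 1 = 2 * p ^ c \<and> c > 0" .
    then have k1: "k = 1" and rp: "p dvd r + 1" by (auto simp: dvd_power)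
    have "\<not> r\<^sup>2 dvd M" using k(1,3) k1 prime_gt_0_nat[OF r(1)] by (simp add: power2_eq_square)
    then show ?thesis using rp 2(1) k1 by simp
  qed
qed

text \<open>Two such primes would contribute two even factors to \<open>divisor_sigma M\<close>, so
  4 would divide \<open>2 * p ^ a\<close>.\<close>

lemma even_sigma_prime_factor_unique:
  fixes p a M r s :: nat
  assumes p: "odd p" and M: "M > 0" "divisor_sigma M dvd 2 * p ^ a"
    and r: "prime r" "r dvd M" "even (divisor_sigma r)" "\<not> r\<^sup>2 dvd M"
    and s: "prime s" "s dvd M" "even (divisor_sigma s)" "\<not> s\<^sup>2 dvd M"
  shows "r = s"
proof (rule ccontr)
  assume ne: "r \<noteq> s"
  then have cop: "coprime r s" using r s by (simp add: primes_coprime)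
  then have "r * s dvd M" using r s by (simp add: divides_mult)
  then obtain L where L: "M = r * s * L" by auto
  have rs0: "r > 0" "s > 0" "L > 0" using M L by (auto intro: Nat.gr0I)
  have nr: "\<not> r dvd L" using r(4) by (auto simp: L power2_eq_square mult.commute mult.left_commute mult_dvd_mono)
  have ns: "\<not> s dvd L" using s(4) by (auto simp: L power2_eq_square mult.commute mult.left_commute mult_dvd_mono)
  have "coprime r L" "coprime s L" using nr ns r s by (auto intro: prime_imp_coprime)
  then have "divisor_sigma M = divisor_sigma r * divisor_sigma s * divisor_sigma L"
    using cop rs0 by (simp add: L divisor_sigma_mult_coprime)
  then have "2 * 2 dvd divisor_sigma M" using r(3) s(3) by (metis dvd_mult2 mult_dvd_mono)
  then have "2 * 2 dvd 2 * p ^ a" using M(2) dvd_trans by blast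
  then show False using p by simp
qed

section \<open>Excluding the cofactors 1 and 2\<close>

lemma no_small_cofactor:
  fixes p a M m :: nat
  assumes p: "prime p" "odd p" and a: "a > 0" and M: "odd M"
    and m: "m = 1 \<or> m = 2"
    and s1: "m * divisor_sigma (p ^ a) = 2 * M" and s2: "divisor_sigma M = m * p ^ a"
  shows False
proof -
  have M0: "M > 0" using M by (cases M) auto
  have p0: "p > 0" using p prime_gt_0_nat by simp
  have dM: "M dvd divisor_sigma (p ^ a)" using m s1 by auto
  have sM: "divisor_sigma M dvd 2 * p ^ a" using m s2 by auto
  have pf: "r dvd a + 1 \<or> (even (divisor_sigma r) \<and> p dvd r + 1 \<and> \<not> r\<^sup>2 dvd M)"
    if "prime r" "r dvd M" for r
    using prime_factor_cases[OF p M sM dM that] .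
  define P where "P = {e. prime e \<and> odd e \<and> e dvd a + 1}"
  have finP: "finite P" unfolding P_def by (rule finite_subset[of _ "{..a + 1}"]) (auto dest: dvd_imp_le)
  \<comment> \<open>If \<open>m = 1\<close>, then \<open>divisor_sigma M\<close> is odd, so no prime
    of \<open>M\<close> is exceptional and each divides \<open>a + 1\<close>. If
    \<open>m = 2\<close>, then \<open>divisor_sigma (p ^ a) = M\<close> is odd, so
    \<open>a + 1\<close> is odd and any prime factor of it serves.\<close>
  have "P \<noteq> {}"
  proof (cases "m = 1")
    case True
    have "M \<noteq> 1" 
    proof
      assume "M = 1"
      then have "p ^ a = 1" using s2 True by (simp add: divisor_sigma_def)
      then show False using a prime_gt_1_nat[OF p(1)] by (metis neq0_conv nat_power_eq_Suc_0_iff One_nat_def less_irrefl)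
    qed
    then obtain r where r: "prime r" "r dvd M" using prime_factor_nat by blast
    obtain k M' where k: "divisor_sigma M = divisor_sigma (r ^ k) * divisor_sigma M'" "M = r ^ k * M'" "k > 0" "\<not> r dvd M'"
      using prime_power_split[OF r(1) M0 r(2)] by metis
    have "odd (divisor_sigma M)" using s2 True p by simp
    then have "odd (divisor_sigma (r ^ k))" using k by simp
    moreover have "k = 1" if "\<not> r\<^sup>2 dvd M"
    proof (rule ccontr)
      assume "k \<noteq> 1" then have "2 \<le> k" using k(3) by simp
      then show False using that k(2) by (meson dvd_mult2 le_imp_power_dvd)
    qed
    ultimately have "r dvd a + 1" using pf[OF r] by auto
    moreover have "odd r" using r M by (meson dvd_trans)
    ultimately show ?thesis using r unfolding P_def by blast
  next
    case False
    then have "odd (\<Sum>i<Suc a. p ^ i)" using m s1 M divisor_sigma_prime_power[OF p(1)] by (simp del: sum.lessThan_Suc)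
    then have o: "odd (a + 1)" using odd_geometric_sum_iff[OF p(2), of "Suc a"] by (simp del: sum.lessThan_Suc)
    obtain e where "prime e" "e dvd a + 1" using prime_factor_nat[of "a + 1"] a by auto
    then show ?thesis using o unfolding P_def by (metis (mono_tags, lifting) dvd_trans empty_iff mem_Collect_eq)
  qed
  define e where "e = Max P"
  have "e \<in> P" unfolding e_def using finP \<open>P \<noteq> {}\<close> by simp
  then have e: "prime e" "odd e" "e dvd a + 1" unfolding P_def by auto
  have e_max: "r \<le> e" if "prime r" "odd r" "r dvd a + 1" for r
    unfolding e_def using that finP by (intro Max_ge) (auto simp: P_def)
  define D where "D = (\<Sum>i<e. p ^ i)"
  have "D dvd (\<Sum>i<Suc a. p ^ i)" unfolding D_def using e(3) by (intro geometric_sum_dvd) simp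
  then have "D dvd m * divisor_sigma (p ^ a)" using divisor_sigma_prime_power[OF p(1)] by simp
  then have "D dvd 2 * M" using s1 by simp
  moreover have "odd D" unfolding D_def using odd_geometric_sum_iff[OF p(2)] e by simp
  ultimately have DM: "D dvd M" by (metis coprime_dvd_mult_right_iff coprime_right_2_iff_odd)
  have special: "even (divisor_sigma r) \<and> p dvd r + 1 \<and> \<not> r\<^sup>2 dvd M"
    if r: "prime r" "r dvd D" "r \<noteq> e" for r
  proof -
    have rM: "r dvd M" using r(2) DM dvd_trans by blast
    then have ro: "odd r" using M by (meson dvd_trans)
    have "e dvd r - 1" using prime_divisor_prime_geometric_sum[OF e(1) r(1) p0] r unfolding D_def by blast
    then have "e \<le> r - 1" using prime_gt_1_nat[OF r(1)] by (intro dvd_imp_le) auto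
    then have "\<not> r dvd a + 1" using e_max[OF r(1) ro] prime_gt_1_nat[OF r(1)] by auto
    then show ?thesis using pf[OF r(1) rM] by blast
  qed
  obtain e' where e': "e = Suc (Suc e')" using prime_gt_1_nat[OF e(1)] by (metis One_nat_def less_imp_Suc_add plus_1_eq_Suc add_Suc_right)
  have D1: "D = 1 + p * (\<Sum>i<Suc e'. p ^ i)"
    unfolding D_def e' by (subst sum.lessThan_Suc_shift) (simp add: sum_distrib_left del: sum.lessThan_Suc)
  have De: "D > e"
  proof -
    \<comment> \<open>Termwise comparison, strict at \<open>i = 1\<close>, which occurs because
      \<open>e \<ge> 2\<close>.\<close>
    have "(\<Sum>i<e. 1) < (\<Sum>i<e. p ^ i)"
      by (rule sum_strict_mono_ex1) (use p0 prime_gt_1_nat[OF p(1)] e' in \<open>auto intro!: bexI[of _ 1]\<close>)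
    then show ?thesis unfolding D_def by simp
  qed
  \<comment> \<open>\<open>f\<close> is the full \<open>e\<close>-part of \<open>D\<close>, as
    \<open>e\<^sup>2\<close> does not divide \<open>D\<close>; then \<open>D > e\<close> leaves
    \<open>D'\<close> a prime factor.\<close>
  obtain f D' where f: "D = f * D'" "\<not> e dvd D'" "f = 1 \<or> f = e \<and> e dvd D"
  proof (cases "e dvd D")
    case True
    then obtain D' where D': "D = e * D'" by auto
    have "\<not> e dvd D'"
      using square_not_dvd_prime_geometric_sum[OF e(1,2) p0] D' unfolding D_def[symmetric]
      by (auto simp: power2_eq_square)
    then show ?thesis using that[of e D'] D' True by blast
  next
    case False
    then show ?thesis using that[of 1 D] by simp
  qed
  have "D' \<noteq> 1" using f De prime_gt_1_nat[OF e(1)] by auto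
  then obtain r where r: "prime r" "r dvd D'" using prime_factor_nat by blast
  then have rD: "r dvd D" "r \<noteq> e" using f by auto
  note sr = special[OF r(1) rD]
  obtain D'' where D'': "D' = r * D''" using r by auto
  \<comment> \<open>A further prime \<open>s\<close> would also be exceptional, hence equal to
    \<open>r\<close>, but \<open>r\<^sup>2\<close> does not divide \<open>M\<close>.\<close>
  have "D'' = 1"
  proof (rule ccontr)
    assume "D'' \<noteq> 1"
    then obtain s where s: "prime s" "s dvd D''" using prime_factor_nat by blast
    then have sD: "s dvd D" "s \<noteq> e" using f D'' by auto
    note ss = special[OF s(1) sD]
    have "r = s"
      using even_sigma_prime_factor_unique[OF p(2) M0 sM r(1) _ _ _ s(1)] sr ss rD(1) sD(1) DM dvd_trans by blast
    then have "r\<^sup>2 dvd D'" using s(2) D'' by (auto simp: power2_eq_square)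
    then show False using sr f(1) DM by (meson dvd_mult dvd_trans)
  qed
  then have Dr: "D = f * r" using f D'' by simp
  \<comment> \<open>Modulo \<open>p\<close>, \<open>r\<close> is -1 and \<open>D = f * r\<close> is
    1, so \<open>f\<close> is -1.\<close>
  have "p dvd f + 1"
  proof -
    have "p dvd f * (r + 1)" using sr dvd_mult by blast
    also have "f * (r + 1) = (f + 1) + p * (\<Sum>i<Suc e'. p ^ i)" using Dr D1 by simp
    finally show ?thesis by (metis dvd_add_left_iff dvd_triv_left)
  qed
  then have ple: "p \<le> f + 1" by (simp add: dvd_imp_le)
  from f(3) show False
  proof
    assume "f = 1"
    then show False using ple p(2) prime_gt_1_nat[OF p(1)] by (auto simp: le_Suc_eq)
  next
    assume fe: "f = e \<and> e dvd D"
    then have "e dvd p - 1" using dvd_prime_geometric_sum_imp_dvd_pred[OF e(1) p0] unfolding D_def by blast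
    then have "e \<le> p - 1" using prime_gt_1_nat[OF p(1)] by (intro dvd_imp_le) auto
    then have "p = e + 1" using ple fe prime_gt_1_nat[OF p(1)] by linarith
    then show False using p(2) e(2) by simp
  qed
qed

section \<open>The bound for a single prime power and the theorem\<close>

lemma sigma_prime_power_bound:
  fixes p a M :: nat
  assumes p: "prime p" and a: "a > 0" and M: "coprime (p ^ a) M" and N: "odd_perfect (p ^ a * M)"
  shows "3 * divisor_sigma (p ^ a) \<le> 2 * M"
proof -
  have o: "odd (p ^ a * M)" and pos: "p ^ a > 0" "M > 0" 
    and s: "divisor_sigma (p ^ a * M) = 2 * (p ^ a * M)" using N unfolding odd_perfect_def by auto
  then have op: "odd p" "odd M" using a by auto
  have s': "divisor_sigma (p ^ a) * divisor_sigma M = 2 * (p ^ a * M)"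
    using divisor_sigma_mult_coprime[OF M pos] s by simp
  have "divisor_sigma (p ^ a) = 1 + p * (\<Sum>i<a. p ^ i)"
    unfolding divisor_sigma_prime_power[OF p]
    by (subst sum.lessThan_Suc_shift) (simp add: sum_distrib_left)
  \<comment> \<open>Being 1 modulo \<open>p\<close>, \<open>divisor_sigma (p ^ a)\<close> absorbs no
    factor \<open>p\<close>, so all of \<open>p ^ a\<close> divides
    \<open>divisor_sigma M\<close>.\<close>
  then have "coprime (p ^ a) (divisor_sigma (p ^ a))"
    using p by (metis coprime_power_left_iff dvd_add_left_iff dvd_triv_left not_prime_unit prime_imp_coprime)
  moreover have "p ^ a dvd divisor_sigma (p ^ a) * divisor_sigma M" using s' by simp
  ultimately have "p ^ a dvd divisor_sigma M" by (simp add: coprime_dvd_mult_right_iff)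
  then obtain m where m: "divisor_sigma M = m * p ^ a" by (metis dvdE mult.commute)
  have s1: "m * divisor_sigma (p ^ a) = 2 * M"
  proof -
    have "p ^ a * (m * divisor_sigma (p ^ a)) = p ^ a * (2 * M)"
      using s' m by (simp add: algebra_simps)
    then show ?thesis using pos(1) by (metis mult_left_cancel neq0_conv)
  qed
  have "m \<noteq> 0" using s1 pos by (intro notI) simp
  moreover have "\<not> (m = 1 \<or> m = 2)" using no_small_cofactor[OF p op(1) a op(2) _ s1 m] by blast
  ultimately have "3 \<le> m" by linarith
  then show ?thesis using s1 by (metis mult_le_mono1)
qed

theorem theorem4p2p5:
  fixes N t :: nat and p \<alpha> :: "nat \<Rightarrow> nat"
  assumes "odd_perfect N"
    and "N = (\<Prod>i=1..t. p i ^ \<alpha> i)"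
    and "\<And>i. i \<in> {1..t} \<Longrightarrow> prime (p i)"
    and "strict_mono_on {1..t} p"
    and "t = prime_omega N"
    and "\<And>i. i \<in> {1..t} \<Longrightarrow> 0 < \<alpha> i"
  shows "\<forall>i\<in>{1..t}. real (divisor_sigma (p i ^ \<alpha> i))
           \<le> 2 / 3 * (real N / real (p i ^ \<alpha> i))"
proof
  fix i assume i: "i \<in> {1..t}"
  define M where "M = (\<Prod>j\<in>{1..t} - {i}. p j ^ \<alpha> j)"
  have NM: "N = p i ^ \<alpha> i * M" unfolding M_def assms(2) using i by (simp add: prod.remove)
  have "coprime (p i ^ \<alpha> i) M" unfolding M_def
  proof (rule prod_coprime_right)
    fix j assume j: "j \<in> {1..t} - {i}"
    then have "p i \<noteq> p j" using strict_mono_on_imp_inj_on[OF assms(4)] i by (auto dest: inj_onD)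
    then show "coprime (p i ^ \<alpha> i) (p j ^ \<alpha> j)" using assms(3) i j by (simp add: primes_coprime)
  qed
  then have "3 * divisor_sigma (p i ^ \<alpha> i) \<le> 2 * M"
    using sigma_prime_power_bound[OF assms(3)[OF i] assms(6)[OF i]] assms(1) NM by simp
  then have "3 * real (divisor_sigma (p i ^ \<alpha> i)) \<le> 2 * real M" by linarith
  moreover have "real N / real (p i ^ \<alpha> i) = real M"
    using NM prime_gt_0_nat[OF assms(3)[OF i]] by simp
  ultimately show "real (divisor_sigma (p i ^ \<alpha> i)) \<le> 2 / 3 * (real N / real (p i ^ \<alpha> i))"
    by simp
qed

end
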